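(* Let $a,b\in\mathbb{R}$ with $0<a<b$, and let $n\in\mathbb{Z}$ with $|n|\geq1$ and $n\neq-1$. Then, for all $q>1$, with $p$ defined by $\frac1p+\frac1q=1$, $$\left|A\left(a^{n},b^{n}\right)-L_{n}(a,b)^{n}\right|\leq|n|(b-a)\left(\frac{2}{(p+1)(p+2)}\right)^{\frac1p}\left[A\left(|a|^{q(n-1)},|b|^{q(n-1)}\right)\right]^{\frac1q}.$$
   Context: For $a,b\ge 0$, the arithmetic mean is $A(a,b)=\frac{a+b}{2}$. For $r\in\mathbb{R}\setminus\{-1,0\}$ and $a,b>0$ with $a\neq b$, the $r$-logarithmic mean is $L_{r}(a,b)=\left[\frac{b^{r+1}-a^{r+1}}{(r+1)(b-a)}\right]^{1/r}$ (and $L_r(a,a)=a$). *)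

theory Defs
  imports Complex_Main
begin

definition arith_mean :: "real \<Rightarrow> real \<Rightarrow> real" where
  "arith_mean a b = (a + b) / 2"

(* Meaningful only for a, b > 0 and r not in {-1, 0}; other values are junk. *)
definition log_mean :: "real \<Rightarrow> real \<Rightarrow> real \<Rightarrow> real" where
  "log_mean r a b =
     (if a = b then a
      else ((b powr (r + 1) - a powr (r + 1)) / ((r + 1) * (b - a))) powr (1 / r))"

end

theory Submission
  imports Defs "HOL-Analysis.Harmonic_Numbers"
begin

text \<open>Write \<open>f x = x\<^sup>n\<close>, and let \<open>M\<close> be the larger of \<open>a\<^sup>n\<^sup>-\<^sup>1\<close> and \<open>b\<^sup>n\<^sup>-\<^sup>1\<close>. The number
  \<open>L\<^sub>n(a, b)\<^sup>n\<close> is the mean of \<open>f\<close> over \<open>[a, b]\<close>. The mean value theorem on the two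
  halves of the interval replaces it by the average of two values of \<open>f\<close>, one from each half.
  As \<open>f\<close> is monotone, the two resulting errors have opposite signs, so that the left-hand side is at
  most \<open>\<bar>n\<bar>(b - a)M/4\<close>. On the right-hand side the arithmetic mean is at least \<open>M\<^sup>q/2\<close>, and
  what remains is the scalar inequality \<open>(p + 1)(p + 2) \<le> 4 \<cdot> 2\<^sup>p\<close>.\<close>

text \<open>The increments \<open>f y - f a\<close> and \<open>f b - f z\<close> each span at most
  half of the interval, so both lie between 0 and \<open>M * (b - a) / 2\<close>. The error is half
  of their difference, hence at most \<open>M * (b - a) / 4\<close>; the triangle inequality alone
  would give twice that.\<close>

lemma trapezoid_error_mono:
  fixes F f f' :: "real \<Rightarrow> real"
  assumes ab: "a < b"
    and F: "\<And>x. a \<le> x \<Longrightarrow> x \<le> b \<Longrightarrow> (F has_real_derivative f x) (at x)"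
    and f: "\<And>x. a \<le> x \<Longrightarrow> x \<le> b \<Longrightarrow> (f has_real_derivative f' x) (at x)"
    and f'_nonneg: "\<And>x. a \<le> x \<Longrightarrow> x \<le> b \<Longrightarrow> 0 \<le> f' x"
    and f'_le: "\<And>x. a \<le> x \<Longrightarrow> x \<le> b \<Longrightarrow> f' x \<le> M"
  shows "\<bar>(f a + f b) / 2 - (F b - F a) / (b - a)\<bar> \<le> M * (b - a) / 4"
proof -
  define m where "m = (a + b) / 2"
  have m: "a < m" "m < b" using ab by (auto simp: m_def)
  obtain y where y: "a < y" "y < m" "F m - F a = (m - a) * f y"
    using MVT2[of a m F f] F m by force
  obtain z where z: "m < z" "z < b" "F b - F m = (b - m) * f z"
    using MVT2[of m b F f] F m by force
  have increment: "0 \<le> f v - f u \<and> f v - f u \<le> M * (b - a) / 2"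
    if uv: "a \<le> u" "u < v" "v \<le> b" "v - u \<le> (b - a) / 2" for u v
  proof -
    obtain w where w: "u < w" "w < v" "f v - f u = (v - u) * f' w"
      using MVT2[of u v f f'] f uv by force
    have "0 \<le> f' w" "f' w \<le> M" using f'_nonneg f'_le w uv by auto
    then have "(v - u) * f' w \<le> ((b - a) / 2) * M"
      using uv by (intro mult_mono) auto
    then show ?thesis using w uv \<open>0 \<le> f' w\<close> by (simp add: mult.commute)
  qed
  \<comment> \<open>Both halves have length \<open>(b - a) / 2\<close>, so the two intermediate
    values get equal weight.\<close>
  have "F b - F a = (b - a) * ((f y + f z) / 2)"
    using y(3) z(3) by (simp add: m_def field_simps)
  then have "(F b - F a) / (b - a) = (f y + f z) / 2" using ab by simp
  then have error: "(f a + f b) / 2 - (F b - F a) / (b - a) = ((f b - f z) - (f y - f a)) / 2"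
    by (simp add: field_simps)
  have "0 \<le> f y - f a \<and> f y - f a \<le> M * (b - a) / 2"
    using y m by (intro increment) (auto simp: m_def)
  moreover have "0 \<le> f b - f z \<and> f b - f z \<le> M * (b - a) / 2"
    using z m by (intro increment) (auto simp: m_def field_simps)
  ultimately show ?thesis unfolding error by (auto simp: abs_if field_simps)
qed

lemma powr_le_max_endpoints:
  fixes a b x s :: real
  assumes "0 < a" "a \<le> x" "x \<le> b"
  shows "x powr s \<le> max (a powr s) (b powr s)"
proof (cases "0 \<le> s")
  case True
  then have "x powr s \<le> b powr s" using assms by (intro powr_mono2) auto
  then show ?thesis by simp
next
  case False
  then have "x powr s \<le> a powr s" using assms by (intro powr_mono2') auto
  then show ?thesis by simp
qed

lemma trapezoid_error_powr:
  fixes a b r :: real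
  assumes ab: "0 < a" "a < b" and r: "r \<noteq> -1"
  shows "\<bar>(a powr r + b powr r) / 2 - (b powr (r + 1) - a powr (r + 1)) / ((r + 1) * (b - a))\<bar>
    \<le> \<bar>r\<bar> * max (a powr (r - 1)) (b powr (r - 1)) * (b - a) / 4"
proof -
  let ?M = "max (a powr (r - 1)) (b powr (r - 1))"
  define F where "F = (\<lambda>x. x powr (r + 1) / (r + 1))"
  have F: "(F has_real_derivative x powr r) (at x)" if "a \<le> x" for x
    unfolding F_def using that ab r by (auto intro!: derivative_eq_intros)
  have f: "((\<lambda>x. x powr r) has_real_derivative r * x powr (r - 1)) (at x)" if "a \<le> x" for x
    using that ab by (auto intro!: derivative_eq_intros)
  have M: "x powr (r - 1) \<le> ?M" if "a \<le> x" "x \<le> b" for x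
    using powr_le_max_endpoints ab(1) that by blast
  have "\<bar>(a powr r + b powr r) / 2 - (F b - F a) / (b - a)\<bar> \<le> \<bar>r\<bar> * ?M * (b - a) / 4"
  proof (cases "0 \<le> r")
    case True
    show ?thesis
      by (rule trapezoid_error_mono[OF ab(2), where f' = "\<lambda>x. r * x powr (r - 1)"])
        (use F f M True in \<open>auto intro!: mult_left_mono\<close>)
  next
    case False
    \<comment> \<open>For negative \<open>r\<close> the power is decreasing. Negating it and
      \<open>F\<close> makes the derivative nonnegative and only flips the sign of the
      error.\<close>
    have "\<bar>(- (a powr r) + - (b powr r)) / 2 - (- F b - - F a) / (b - a)\<bar>
        \<le> \<bar>r\<bar> * ?M * (b - a) / 4"
      by (rule trapezoid_error_mono[OF ab(2), where f' = "\<lambda>x. - (r * x powr (r - 1))"])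
        (use DERIV_minus[OF F] DERIV_minus[OF f] M False in
          \<open>auto simp: mult_nonpos_nonneg intro!: mult_left_mono_neg\<close>)
    moreover have "(- (a powr r) + - (b powr r)) / 2 - (- F b - - F a) / (b - a)
        = - ((a powr r + b powr r) / 2 - (F b - F a) / (b - a))"
      using ab by (simp add: field_simps)
    ultimately show ?thesis by (simp only: abs_minus_cancel)
  qed
  moreover have "(F b - F a) / (b - a)
      = (b powr (r + 1) - a powr (r + 1)) / ((r + 1) * (b - a))"
    by (simp add: F_def diff_divide_distrib)
  ultimately show ?thesis by simp
qed

lemma log_mean_powi:
  fixes a b :: real and n :: int
  assumes ab: "0 < a" "a < b" and n: "n \<noteq> 0" "n \<noteq> -1"
  shows "log_mean (of_int n) a b powi n
    = (b powr (of_int n + 1) - a powr (of_int n + 1)) / ((of_int n + 1) * (b - a))"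
    (is "_ = ?X")
proof -
  let ?r = "of_int n :: real"
  have r: "?r + 1 \<noteq> 0" using n(2) by linarith
  \<comment> \<open>The exponents \<open>1 / ?r\<close> and \<open>n\<close> are cancelled below for
    a positive base. As \<open>?r + 1\<close> may have either sign, it stays with the powers: each
    quotient has the positive derivative \<open>x powr ?r\<close>.\<close>
  have "a powr (?r + 1) / (?r + 1) < b powr (?r + 1) / (?r + 1)"
  proof (rule DERIV_pos_imp_increasing[OF ab(2)])
    fix x assume "a \<le> x" "x \<le> b"
    then have "((\<lambda>x. x powr (?r + 1) / (?r + 1)) has_real_derivative x powr ?r) (at x)"
      "0 < x powr ?r"
      using ab r by (auto intro!: derivative_eq_intros)
    then show "\<exists>y. ((\<lambda>x. x powr (?r + 1) / (?r + 1)) has_real_derivative y) (at x) \<and> 0 < y"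
      by blast
  qed
  then have "0 < (b powr (?r + 1) / (?r + 1) - a powr (?r + 1) / (?r + 1)) / (b - a)"
    using ab by simp
  also have "\<dots> = ?X" by (simp add: diff_divide_distrib)
  finally have X: "0 < ?X" .
  have "(x powr (1 / ?r)) powi n = x" if "0 < x" for x
  proof -
    have "(x powr (1 / ?r)) powi n = (x powr (1 / ?r)) powr ?r"
      using that by (subst powr_real_of_int') auto
    then show ?thesis using that n by (simp add: powr_powr)
  qed
  from this[OF X] show ?thesis using ab by (simp add: log_mean_def)
qed

text \<open>With \<open>x = p - 1\<close> the right-hand side is \<open>8 * exp (x * ln 2)\<close>.
  The quadratic Taylor bound and \<open>ln 2 \<ge> 2 / 3\<close> give it a lower bound with
  coefficients 8, 16/3, 16/9 in \<open>x\<close>, against 6, 5, 1 on the left. Without the shift the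
  leading coefficient would be only 8/9.\<close>

lemma quadratic_le_two_powr:
  fixes p :: real
  assumes "1 \<le> p"
  shows "(p + 1) * (p + 2) \<le> 4 * 2 powr p"
proof -
  define x where "x = p - 1"
  have x: "0 \<le> x" using assms by (simp add: x_def)
  define u where "u = x * (2 / 3)"
  have "u \<le> x * ln 2"
    unfolding u_def using x ln2_ge_two_thirds by (intro mult_left_mono) auto
  have "(p + 1) * (p + 2) = x\<^sup>2 + 5 * x + 6"
    by (simp add: x_def power2_eq_square algebra_simps)
  also have "\<dots> \<le> 8 * (1 + u + u\<^sup>2 / 2)"
    using x by (simp add: u_def power2_eq_square field_simps)
  also have "\<dots> \<le> 8 * exp u"
    using exp_lower_Taylor_quadratic[of u] x by (simp add: u_def)
  also have "\<dots> \<le> 8 * exp (x * ln 2)"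
    using \<open>u \<le> x * ln 2\<close> by simp
  also have "\<dots> = 4 * 2 powr p"
    by (simp add: x_def powr_def left_diff_distrib exp_diff)
  finally show ?thesis .
qed

text \<open>Since \<open>1 / q = 1 - 1 / p\<close>, the right-hand side is half of the
  \<open>p\<close>-th root of \<open>4 / ((p + 1) * (p + 2))\<close>, and that root is at least 1/2
  by \<open>quadratic_le_two_powr\<close>.\<close>

lemma quarter_le_const:
  fixes p q :: real
  assumes "1 < p" "1 / p + 1 / q = 1"
  shows "1 / 4 \<le> (2 / ((p + 1) * (p + 2))) powr (1 / p) * (1 / 2) powr (1 / q)"
proof -
  let ?d = "(p + 1) * (p + 2)"
  have d: "0 < ?d" using assms by simp
  have "1 / q = 1 - 1 / p" using assms(2) by simp
  then have q: "(1 / 2 :: real) powr (1 / q) = 1 / 2 * 2 powr (1 / p)"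
    by (simp add: powr_diff powr_divide)
  have "2 powr (- p) \<le> 4 / ?d"
    using quadratic_le_two_powr[of p] assms d by (simp add: powr_minus divide_simps mult.commute)
  then have "(2 powr (- p)) powr (1 / p) \<le> (4 / ?d) powr (1 / p)"
    using assms by (intro powr_mono2) auto
  moreover have "(2 powr (- p)) powr (1 / p) = (1 / 2 :: real)"
    using assms by (simp add: powr_powr powr_neg_one)
  moreover have "(4 / ?d) powr (1 / p) = (2 / ?d) powr (1 / p) * 2 powr (1 / p)"
    using d by (subst powr_mult[symmetric]) auto
  ultimately show ?thesis unfolding q by simp
qed

lemma max_le_power_mean:
  fixes u v q :: real
  assumes "0 \<le> u" "0 \<le> v" "0 < q"
  shows "max u v * (1 / 2) powr (1 / q) \<le> arith_mean (u powr q) (v powr q) powr (1 / q)"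
proof -
  have "max u v * (1 / 2) powr (1 / q) = (max u v powr q * (1 / 2)) powr (1 / q)"
    using assms by (subst powr_mult) (auto simp: powr_powr)
  also have "\<dots> \<le> arith_mean (u powr q) (v powr q) powr (1 / q)"
    using assms by (intro powr_mono2) (auto simp: arith_mean_def max_def)
  finally show ?thesis .
qed

theorem proposition2:
  fixes a b p q :: real and n :: int
  assumes "0 < a" and "a < b"
    and "\<bar>n\<bar> \<ge> 1" and "n \<noteq> -1"
    and "q > 1" and "1 / p + 1 / q = 1"
  shows "\<bar>arith_mean (a powi n) (b powi n) - log_mean (of_int n) a b powi n\<bar>
    \<le> \<bar>of_int n\<bar> * (b - a) * (2 / ((p + 1) * (p + 2))) powr (1 / p)
       * (arith_mean (\<bar>a\<bar> powr (q * (of_int n - 1))) (\<bar>b\<bar> powr (q * (of_int n - 1)))) powr (1 / q)"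
proof -
  let ?r = "of_int n :: real"
  let ?u = "a powr (?r - 1)" and ?v = "b powr (?r - 1)"
  let ?c = "(2 / ((p + 1) * (p + 2))) powr (1 / p)"
  let ?S = "arith_mean (?u powr q) (?v powr q) powr (1 / q)"
  \<comment> \<open>The reciprocals lie strictly between 0 and 1. As \<open>1 / 0 = 0\<close>, this
    also excludes \<open>p = 0\<close>, so \<open>1 < p\<close>.\<close>
  have "0 < 1 / q" "1 / q < 1" using assms(5) by simp_all
  then have "0 < 1 / p" "1 / p < 1" using assms(6) by linarith+
  then have p: "1 < p" by (simp add: divide_less_eq zero_less_divide_iff split: if_splits)
  have "max ?u ?v * (1 / 4) \<le> max ?u ?v * (?c * (1 / 2) powr (1 / q))"
    using quarter_le_const[OF p assms(6)] by (intro mult_left_mono) (auto simp: max_def)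
  also have "\<dots> = ?c * (max ?u ?v * (1 / 2) powr (1 / q))" by simp
  also have "\<dots> \<le> ?c * ?S"
    using assms by (intro mult_left_mono max_le_power_mean) auto
  finally have S: "max ?u ?v / 4 \<le> ?c * ?S" by simp
  have powi: "x powi n = x powr ?r" if "0 < x" for x
    using that by (subst powr_real_of_int') auto
  have "n \<noteq> 0" "?r \<noteq> -1" using assms(3,4) by linarith+
  then have "\<bar>arith_mean (a powi n) (b powi n) - log_mean ?r a b powi n\<bar>
      \<le> \<bar>?r\<bar> * max ?u ?v * (b - a) / 4"
    using trapezoid_error_powr[of a b ?r] assms log_mean_powi[of a b n]
    by (simp add: powi arith_mean_def)
  also have "\<dots> = \<bar>?r\<bar> * (b - a) * (max ?u ?v / 4)" by simp
  also have "\<dots> \<le> \<bar>?r\<bar> * (b - a) * (?c * ?S)"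
    using S assms by (intro mult_left_mono) auto
  also have "?S = arith_mean (\<bar>a\<bar> powr (q * (?r - 1))) (\<bar>b\<bar> powr (q * (?r - 1))) powr (1 / q)"
    using assms by (simp add: powr_powr mult.commute)
  finally show ?thesis by (simp add: mult.assoc)
qed

end
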